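(* Assume the abc conjecture. Then for every $\epsilon>0$ there exists a constant $C'_\epsilon>0$ such that for all positive integers $a$ and $b$ with $a<b$ and $a^2(a^2+1)$ dividing $b^2(b^2+1)$, we have \[ b \ge C'_\epsilon\, a^{15/14-\epsilon}. \]
   Context: For a positive integer $n$, the radical is $R(n)=\prod_{p\mid n} p$ (product over distinct primes dividing $n$). The abc conjecture asserts: for every $\epsilon>0$ there exists a constant $C_\epsilon$ such that for all triples $(a,b,c)$ of pairwise coprime positive integers with $a+b=c$, one has $c < C_\epsilon R(abc)^{1+\epsilon}$. *)

theory Defs
  imports Complex_Main "HOL-Computational_Algebra.Primes"
begin

definition nat_radical :: "nat \<Rightarrow> nat" where
  "nat_radical n = \<Prod>(prime_factors n)"

definition abc_conjecture :: bool where
  "abc_conjecture \<longleftrightarrow>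
     (\<forall>\<epsilon>::real. \<epsilon> > 0 \<longrightarrow>
       (\<exists>C::real. \<forall>a b c::nat.
          a > 0 \<longrightarrow> b > 0 \<longrightarrow> c > 0 \<longrightarrow>
          coprime a b \<longrightarrow> coprime a c \<longrightarrow> coprime b c \<longrightarrow>
          a + b = c \<longrightarrow>
          real c < C * real (nat_radical (a * b * c)) powr (1 + \<epsilon>)))"

end

theory Submission
  imports Defs
begin

text \<open>
  Put \<open>u = gcd a b\<close>, \<open>a = u v\<close> and \<open>z = gcd (a\<^sup>2 + 1) (b\<^sup>2)\<close>. The divisibility splits as
  \<open>a\<^sup>2 + 1 = z w\<close>, \<open>b\<^sup>2 = u\<^sup>2 z s\<close>, \<open>b\<^sup>2 + 1 = v\<^sup>2 w r\<close>, and eliminating \<open>z\<close> gives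
  \<open>v\<^sup>2 (w\<^sup>2 r - s u\<^sup>4) = w + s u\<^sup>2\<close>. Hence \<open>D = w\<^sup>2 r - s u\<^sup>4\<close> is positive and small, and the abc
  conjecture for \<open>s u\<^sup>4 + D = w\<^sup>2 r\<close> yields essentially \<open>w \<le> D s u\<close>. Since \<open>w\<close> divides
  \<open>(b\<^sup>2 - a\<^sup>2) / u\<^sup>2 > 0\<close>, also \<open>u\<^sup>4 \<le> r a\<^sup>2\<close>; together with \<open>s r a\<^sup>4 \<le> b\<^sup>4\<close> these bounds give
  \<open>a ^ 26 \<le> C b ^ (24 + 32 \<epsilon>)\<close>. For \<open>\<epsilon> = 1 / 120\<close> the quotient \<open>26 / (24 + 32 \<epsilon>)\<close> of the exponents
  is exactly \<open>15 / 14\<close>.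
\<close>

text \<open>This avoids computing radicals: any positive \<open>m\<close> divisible by the same
  primes serves as an upper bound.\<close>

lemma nat_radical_le:
  assumes "m > 0" and "\<And>p. prime p \<Longrightarrow> p dvd n \<Longrightarrow> p dvd m"
  shows "nat_radical n \<le> m"
proof -
  have sub: "prime_factors n \<subseteq> prime_factors m"
    using assms by (auto simp: prime_factors_dvd)
  have "nat_radical n dvd \<Prod>(prime_factors m)"
    unfolding nat_radical_def using sub by (intro prod_dvd_prod_subset) auto
  also have "\<Prod>(prime_factors m) dvd (\<Prod>p\<in>prime_factors m. p ^ multiplicity p m)"
    by (rule prod_dvd_prod) (auto simp: prime_factors_multiplicity)
  also have "\<dots> = m"
    using assms(1) by (simp add: prime_factorization_nat[symmetric])
  finally show ?thesis using assms(1) by (auto dest: dvd_imp_le)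
qed

text \<open>Divisors of \<open>a\<^sup>2\<close> are coprime to divisors of
  \<open>a\<^sup>2 + 1\<close>, so divisibilities of the two kinds multiply. Dividing out the gcds
  leaves \<open>v\<close> coprime to \<open>m\<close> and \<open>w\<close> coprime to
  \<open>n\<close>, which forces \<open>v\<^sup>2\<close> and \<open>w\<close> into
  \<open>b\<^sup>2 + 1\<close>.\<close>

lemma divisibility_factorization:
  fixes a b :: nat
  assumes "a > 0" and "b > 0" and dvd: "a\<^sup>2 * (a\<^sup>2 + 1) dvd b\<^sup>2 * (b\<^sup>2 + 1)"
  obtains u v m z w s r where
    "a = u * v" "b = u * m" "coprime u w"
    "a\<^sup>2 + 1 = z * w" "b\<^sup>2 = u\<^sup>2 * z * s" "b\<^sup>2 + 1 = v\<^sup>2 * w * r"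
proof -
  define u where "u = gcd a b"
  obtain v m where v: "a = u * v" and m: "b = u * m" and vm: "coprime v m"
    using gcd_coprime_exists[of a b] assms(1) unfolding u_def
    by (metis gcd_eq_0_iff mult.commute neq0_conv)
  have u0: "u > 0" using assms(1) by (simp add: u_def)
  define z where "z = gcd (a\<^sup>2 + 1) (b\<^sup>2)"
  obtain w n where w: "a\<^sup>2 + 1 = z * w" and n: "b\<^sup>2 = z * n" and wn: "coprime w n"
    using gcd_coprime_exists[of "a\<^sup>2 + 1" "b\<^sup>2"] assms(2) unfolding z_def
    by (metis gcd_eq_0_iff mult.commute neq0_conv zero_eq_power2)
  have z0: "z > 0" using assms(2) by (simp add: z_def)
  have ca: "coprime (a\<^sup>2) (a\<^sup>2 + 1)" by simp
  have cuv: "coprime x y" if "x dvd a\<^sup>2" "y dvd a\<^sup>2 + 1" for x y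
    using coprime_divisors[OF that ca] .
  have uz: "coprime (u\<^sup>2) z" and vw: "coprime (v\<^sup>2) w" and uw: "coprime u w"
    using v w by (auto intro!: cuv simp del: One_nat_def add_Suc_right simp: power_mult_distrib)
  have "u\<^sup>2 * z dvd b\<^sup>2"
    by (rule divides_mult[OF _ _ uz]) (simp_all add: m n z_def power_mult_distrib)
  then obtain s where s: "b\<^sup>2 = u\<^sup>2 * z * s" by (auto elim: dvdE)
  have "v\<^sup>2 dvd b\<^sup>2 + 1"
  proof -
    have "u\<^sup>2 * v\<^sup>2 dvd u\<^sup>2 * (m\<^sup>2 * (b\<^sup>2 + 1))"
      using dvd_trans[OF dvd_triv_left dvd] by (simp only: v m power_mult_distrib mult.assoc)
    then have "v\<^sup>2 dvd m\<^sup>2 * (b\<^sup>2 + 1)" using u0 by (metis dvd_times_left_cancel_iff power_not_zero not_gr_zero)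
    then show ?thesis using vm by (subst (asm) coprime_dvd_mult_right_iff) auto
  qed
  moreover have "w dvd b\<^sup>2 + 1"
  proof -
    have "z * w dvd b\<^sup>2 * (b\<^sup>2 + 1)"
      using dvd_trans[OF dvd_triv_right dvd] by (simp only: w)
    then have "z * w dvd z * (n * (b\<^sup>2 + 1))" by (simp only: n mult.assoc)
    then have "w dvd n * (b\<^sup>2 + 1)" using z0 by (metis dvd_times_left_cancel_iff not_gr_zero)
    then show ?thesis using wn by (subst (asm) coprime_dvd_mult_right_iff) auto
  qed
  ultimately have "v\<^sup>2 * w dvd b\<^sup>2 + 1" using vw by (intro divides_mult)
  then obtain r where "b\<^sup>2 + 1 = v\<^sup>2 * w * r" by (auto elim: dvdE)
  then show thesis using that v m uw w s by blast
qed

text \<open>The equations in \<open>D\<close> supply the abc triple; the last two inequalities serve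
  to eliminate first \<open>u\<close> and then \<open>s * r\<close>.\<close>

lemma abc_triple_of_divisibility:
  fixes a b :: nat
  assumes "a > 0" and "a < b" and "a\<^sup>2 * (a\<^sup>2 + 1) dvd b\<^sup>2 * (b\<^sup>2 + 1)"
  obtains u v w s r D where
    "u > 0" "v > 0" "w > 0" "s > 0" "r > 0" "D > 0"
    "a = u * v" "b\<^sup>2 + 1 = v\<^sup>2 * w * r" "s * u \<le> b\<^sup>2"
    "s * u ^ 4 + D = w\<^sup>2 * r" "v\<^sup>2 * D = w + s * u\<^sup>2" "coprime (s * u ^ 4) (w\<^sup>2 * r)"
    "u ^ 4 \<le> r * a\<^sup>2" "s * r * a ^ 4 \<le> b ^ 4"
proof -
  obtain u v m z w s r where v: "a = u * v" and m: "b = u * m" and uw: "coprime u w"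
    and w: "a\<^sup>2 + 1 = z * w" and s: "b\<^sup>2 = u\<^sup>2 * z * s" and r: "b\<^sup>2 + 1 = v\<^sup>2 * w * r"
    using divisibility_factorization[OF assms(1) _ assms(3)] assms(2)
    by (metis gr_implies_not0 neq0_conv)
  have pos: "u > 0" "v > 0" "w > 0" "s > 0" "r > 0" "z > 0" "m > 0"
    using assms v w s r m by (auto intro!: Nat.gr0I)
  \<comment> \<open>Evaluate \<open>w * (b\<^sup>2 + 1)\<close> through both factorizations,
    replacing \<open>z * w\<close> by \<open>u\<^sup>2 * v\<^sup>2 + 1\<close>.\<close>
  have key: "v\<^sup>2 * (w\<^sup>2 * r) = v\<^sup>2 * (s * u ^ 4) + (w + s * u\<^sup>2)"
  proof -
    have "v\<^sup>2 * (w\<^sup>2 * r) = w * (b\<^sup>2 + 1)" unfolding r by (simp add: power2_eq_square)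
    also have "\<dots> = s * u\<^sup>2 * (z * w) + w" unfolding s by (simp add: algebra_simps)
    also have "\<dots> = s * u\<^sup>2 * (u\<^sup>2 * v\<^sup>2 + 1) + w"
      by (simp add: w[symmetric] v power_mult_distrib)
    also have "\<dots> = v\<^sup>2 * (s * u ^ 4) + (w + s * u\<^sup>2)" by algebra
    finally show ?thesis .
  qed
  then have "v\<^sup>2 * (s * u ^ 4) < v\<^sup>2 * (w\<^sup>2 * r)" using pos by simp
  then have lt: "s * u ^ 4 < w\<^sup>2 * r" by simp
  define D where "D = w\<^sup>2 * r - s * u ^ 4"
  have D: "s * u ^ 4 + D = w\<^sup>2 * r" "D > 0" using lt by (simp_all add: D_def)
  have vD: "v\<^sup>2 * D = w + s * u\<^sup>2"
    using key unfolding D(1)[symmetric] by (simp add: distrib_left)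
  \<comment> \<open>\<open>s * u\<close> and \<open>w * r\<close> divide the consecutive numbers
    \<open>b\<^sup>2\<close> and \<open>b\<^sup>2 + 1\<close>; extra powers of \<open>u\<close> and
    \<open>w\<close> preserve coprimality.\<close>
  have b2: "b\<^sup>2 = u * z * (s * u)" and "b\<^sup>2 + 1 = v\<^sup>2 * (w * r)"
    using s r by (simp_all add: power2_eq_square)
  then have "coprime (s * u) (w * r)"
    using coprime_divisors[of "s * u" "b\<^sup>2" "w * r" "b\<^sup>2 + 1"]
    by (metis coprime_add_one_right dvd_triv_right)
  then have cop: "coprime (s * u ^ 4) (w\<^sup>2 * r)" by simp
  have su: "s * u \<le> b\<^sup>2" unfolding b2 using pos by simp
  \<comment> \<open>\<open>w\<close> divides both \<open>a\<^sup>2 + 1\<close> and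
    \<open>b\<^sup>2 + 1\<close>, hence their difference, from which \<open>u\<^sup>2\<close> can be
    cancelled.\<close>
  have "w \<le> m\<^sup>2"
  proof -
    have "v < m" using assms(2) v m pos by simp
    then have vm: "v\<^sup>2 < m\<^sup>2" by (simp add: power_strict_mono)
    have "w dvd (b\<^sup>2 + 1) - (a\<^sup>2 + 1)" by (rule dvd_diff_nat) (simp_all only: r w, simp_all)
    also have "(b\<^sup>2 + 1) - (a\<^sup>2 + 1) = u\<^sup>2 * (m\<^sup>2 - v\<^sup>2)"
      by (simp add: v m power_mult_distrib diff_mult_distrib2)
    finally have "w dvd m\<^sup>2 - v\<^sup>2"
      using uw by (simp add: coprime_dvd_mult_right_iff coprime_commute)
    then have "w \<le> m\<^sup>2 - v\<^sup>2" using vm by (auto dest: dvd_imp_le)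
    then show ?thesis by simp
  qed
  have u4: "u ^ 4 \<le> r * a\<^sup>2"
  proof -
    have "u ^ 4 * m\<^sup>2 = u\<^sup>2 * b\<^sup>2" unfolding m by algebra
    also have "\<dots> \<le> u\<^sup>2 * (b\<^sup>2 + 1)" by simp
    also have "\<dots> = r * a\<^sup>2 * w" unfolding r v by algebra
    also have "\<dots> \<le> r * a\<^sup>2 * m\<^sup>2" using \<open>w \<le> m\<^sup>2\<close> by simp
    finally show ?thesis using pos by simp
  qed
  \<comment> \<open>\<open>s * r\<close> is exactly the quotient of
    \<open>b\<^sup>2 * (b\<^sup>2 + 1)\<close> by \<open>a\<^sup>2 * (a\<^sup>2 + 1)\<close>, and
    (b^2 + 1)/(a^2 + 1) <= b^2/a^2 because a < b.\<close>
  have sr: "s * r * a ^ 4 \<le> b ^ 4"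
  proof -
    have "s * r * a ^ 4 * (a\<^sup>2 + 1) = s * r * a ^ 4 * (z * w)" by (simp only: w)
    also have "\<dots> = a\<^sup>2 * ((u\<^sup>2 * z * s) * (v\<^sup>2 * w * r))"
      unfolding v by algebra
    also have "\<dots> = a\<^sup>2 * (b\<^sup>2 * (b\<^sup>2 + 1))" by (simp only: r s[symmetric])
    also have "\<dots> = b\<^sup>2 * (a\<^sup>2 * b\<^sup>2 + a\<^sup>2)" by algebra
    also have "\<dots> \<le> b\<^sup>2 * (a\<^sup>2 * b\<^sup>2 + b\<^sup>2)" using assms(2) by (simp add: power_mono)
    also have "\<dots> = b ^ 4 * (a\<^sup>2 + 1)" by algebra
    finally show ?thesis by (subst (asm) mult_le_cancel2) auto
  qed
  show thesis using that[OF pos(1-5) D(2) v r su D(1) vD cop u4 sr] .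
qed

text \<open>The fourth power turns \<open>u ^ 3\<close> into \<open>(u ^ 4) ^ 3\<close>, to which
  \<open>u4\<close> applies. Rounding \<open>r ^ 3\<close> up to \<open>r ^ 4\<close> then matches
  the exponent of \<open>s\<close>, so that \<open>sr\<close> applies.\<close>

lemma power_bound_first_case:
  fixes a b u s r L :: real
  assumes "a > 0" "a \<le> b" "u > 0" "s \<ge> 1" "r \<ge> 1" "L > 0"
    and u4: "u ^ 4 \<le> r * a\<^sup>2" and sr: "s * r * a ^ 4 \<le> b ^ 4"
    and le: "a\<^sup>2 \<le> L * s * u ^ 3"
  shows "a ^ 26 \<le> L ^ 4 * b ^ 24"
proof -
  have "a ^ 8 = (a\<^sup>2) ^ 4" by simp
  also have "\<dots> \<le> (L * s * u ^ 3) ^ 4" using le by (intro power_mono) auto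
  also have "\<dots> = L ^ 4 * s ^ 4 * (u ^ 4) ^ 3" by algebra
  also have "\<dots> \<le> L ^ 4 * s ^ 4 * (r * a\<^sup>2) ^ 3"
    using assms by (intro mult_left_mono power_mono) auto
  also have "\<dots> = L ^ 4 * s ^ 4 * a ^ 6 * r ^ 3" by algebra
  also have "\<dots> \<le> L ^ 4 * s ^ 4 * a ^ 6 * r ^ 4"
    using assms by (intro mult_left_mono power_increasing) auto
  finally have 1: "a ^ 8 \<le> L ^ 4 * s ^ 4 * a ^ 6 * r ^ 4" .
  \<comment> \<open>Bound \<open>1\<close> already gives a^18 <= L^4 b^16; the factor a^8 <= b^8
    weakens this to the shape reached in the second case.\<close>
  have "a ^ 26 * a ^ 6 = a ^ 8 * (a ^ 16 * a ^ 8)" by algebra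
  also have "\<dots> \<le> (L ^ 4 * s ^ 4 * a ^ 6 * r ^ 4) * (a ^ 16 * a ^ 8)"
    using 1 assms by (intro mult_right_mono) auto
  also have "\<dots> = L ^ 4 * a ^ 6 * ((s * r * a ^ 4) ^ 4 * a ^ 8)" by algebra
  also have "\<dots> \<le> L ^ 4 * a ^ 6 * ((b ^ 4) ^ 4 * b ^ 8)"
    using assms by (intro mult_left_mono mult_mono power_mono) auto
  also have "\<dots> = L ^ 4 * b ^ 24 * a ^ 6" by algebra
  finally show ?thesis using assms(1) by (subst (asm) mult_le_cancel_right_pos) auto
qed

text \<open>The same elimination, now with \<open>s ^ 8\<close> and \<open>r ^ 7\<close> rounded up
  to \<open>r ^ 8\<close>. This case determines the exponents 26 and 24.\<close>

lemma power_bound_second_case: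
  fixes a b u s r L :: real
  assumes "a > 0" "b > 0" "u > 0" "s \<ge> 1" "r \<ge> 1" "L > 0"
    and u4: "u ^ 4 \<le> r * a\<^sup>2" and sr: "s * r * a ^ 4 \<le> b ^ 4"
    and le: "b\<^sup>2 \<le> L * r * s\<^sup>2 * u ^ 3"
  shows "a ^ 26 \<le> L ^ 4 * b ^ 24"
proof -
  have "b ^ 8 = (b\<^sup>2) ^ 4" by simp
  also have "\<dots> \<le> (L * r * s\<^sup>2 * u ^ 3) ^ 4" using le by (intro power_mono) auto
  also have "\<dots> = L ^ 4 * r ^ 4 * s ^ 8 * (u ^ 4) ^ 3" by algebra
  also have "\<dots> \<le> L ^ 4 * r ^ 4 * s ^ 8 * (r * a\<^sup>2) ^ 3"
    using assms by (intro mult_left_mono power_mono) auto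
  also have "\<dots> = L ^ 4 * s ^ 8 * a ^ 6 * r ^ 7" by algebra
  also have "\<dots> \<le> L ^ 4 * s ^ 8 * a ^ 6 * r ^ 8"
    using assms by (intro mult_left_mono power_increasing) auto
  finally have 1: "b ^ 8 \<le> L ^ 4 * s ^ 8 * a ^ 6 * r ^ 8" .
  have "a ^ 26 * (a ^ 6 * b ^ 8) = b ^ 8 * a ^ 32" by algebra
  also have "\<dots> \<le> (L ^ 4 * s ^ 8 * a ^ 6 * r ^ 8) * a ^ 32"
    using 1 assms by (intro mult_right_mono) auto
  also have "\<dots> = L ^ 4 * a ^ 6 * (s * r * a ^ 4) ^ 8" by algebra
  also have "\<dots> \<le> L ^ 4 * a ^ 6 * (b ^ 4) ^ 8"
    using assms by (intro mult_left_mono power_mono) auto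
  also have "\<dots> = L ^ 4 * b ^ 24 * (a ^ 6 * b ^ 8)" by algebra
  finally show ?thesis using assms(1,2) by (subst (asm) mult_le_cancel_right_pos) auto
qed

lemma abc_conjecture_radical_bound:
  assumes "abc_conjecture" and "\<epsilon> > 0"
  obtains C :: real where "C > 0"
    and "\<And>x y z m :: nat. \<lbrakk>x > 0; y > 0; x + y = z; coprime x z; m > 0;
           \<And>p. prime p \<Longrightarrow> p dvd x * y * z \<Longrightarrow> p dvd m\<rbrakk> \<Longrightarrow> real z \<le> C * real m powr (1 + \<epsilon>)"
proof -
  obtain C where C: "\<And>x y z :: nat. \<lbrakk>x > 0; y > 0; z > 0; coprime x y; coprime x z; coprime y z;
      x + y = z\<rbrakk> \<Longrightarrow> real z < C * real (nat_radical (x * y * z)) powr (1 + \<epsilon>)"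
    using assms unfolding abc_conjecture_def by metis
  have "real z \<le> max C 1 * real m powr (1 + \<epsilon>)"
    if "x > 0" "y > 0" "x + y = z" "coprime x z" "m > 0"
      "\<And>p. prime p \<Longrightarrow> p dvd x * y * z \<Longrightarrow> p dvd m" for x y z m :: nat
  proof -
    have "coprime x y" "coprime y z"
      using that(3,4) by (metis coprime_commute coprime_iff_gcd_eq_1 gcd_add1 gcd_add2)+
    then have "real z < C * real (nat_radical (x * y * z)) powr (1 + \<epsilon>)"
      using C that by auto
    \<comment> \<open>The conjecture does not state the sign of \<open>C\<close>;
      \<open>max C 1\<close> is surely positive.\<close>
    also have "\<dots> \<le> max C 1 * real m powr (1 + \<epsilon>)"
      using nat_radical_le[OF that(5,6)] assms(2) by (intro mult_mono powr_mono2) auto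
    finally show ?thesis by simp
  qed
  then show thesis using that[of "max C 1"] by simp
qed

lemma abc_power_bound:
  assumes "abc_conjecture"
  obtains K :: real where "K > 0"
    and "\<And>a b :: nat. \<lbrakk>a > 0; a < b; a\<^sup>2 * (a\<^sup>2 + 1) dvd b\<^sup>2 * (b\<^sup>2 + 1)\<rbrakk>
           \<Longrightarrow> real a ^ 26 \<le> (K * real b powr (1 / 15)) ^ 4 * real b ^ 24"
proof -
  obtain C :: real where C: "C > 0"
    and abc: "\<And>x y z m :: nat. \<lbrakk>x > 0; y > 0; x + y = z; coprime x z; m > 0;
           \<And>p. prime p \<Longrightarrow> p dvd x * y * z \<Longrightarrow> p dvd m\<rbrakk> \<Longrightarrow> real z \<le> C * real m powr (1 + 1 / 120)"
    using abc_conjecture_radical_bound[OF assms, of "1 / 120"] by auto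
  have "real a ^ 26 \<le> (16 * C * real b powr (1 / 15)) ^ 4 * real b ^ 24"
    if ab: "a > 0" "a < b" and dvd: "a\<^sup>2 * (a\<^sup>2 + 1) dvd b\<^sup>2 * (b\<^sup>2 + 1)" for a b :: nat
  proof -
    obtain u v w s r D :: nat where pos: "u > 0" "v > 0" "w > 0" "s > 0" "r > 0" "D > 0"
      and v: "a = u * v" and r: "b\<^sup>2 + 1 = v\<^sup>2 * w * r" and su: "s * u \<le> b\<^sup>2"
      and D: "s * u ^ 4 + D = w\<^sup>2 * r" and vD: "v\<^sup>2 * D = w + s * u\<^sup>2"
      and cop: "coprime (s * u ^ 4) (w\<^sup>2 * r)"
      and u4: "u ^ 4 \<le> r * a\<^sup>2" and sr: "s * r * a ^ 4 \<le> b ^ 4"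
      by (rule abc_triple_of_divisibility[OF ab dvd])
    \<comment> \<open>\<open>X\<close> has the primes of the abc product but drops the repeated
      factors \<open>u ^ 3\<close> and \<open>w\<close>.\<close>
    define X where "X = s * u * D * (w * r)"
    define E where "E = real b powr (1 / 15)"
    define L where "L = 16 * C * E"
    have E: "E > 0" using ab by (simp add: E_def)
    have L: "L > 0" using C E by (simp add: L_def)
    have X0: "X > 0" using pos by (simp add: X_def)
    have "real (w\<^sup>2 * r) \<le> C * real X powr (1 + 1 / 120)"
    proof (rule abc[OF _ _ D cop X0])
      fix p :: nat assume "prime p" "p dvd s * u ^ 4 * D * (w\<^sup>2 * r)"
      then show "p dvd X"
        unfolding X_def by (auto simp: prime_dvd_mult_iff dest: prime_dvd_power)
    qed (use pos in auto)
    also have "\<dots> = C * real X * real X powr (1 / 120)"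
      using X0 by (simp only: powr_add) simp
    also have "\<dots> \<le> C * real X * (8 * E)"
    \<comment> \<open>The factor with exponent 1/120 needs only a crude bound: X <= 8 b^8 makes it
      at most 8 b^(1/15).\<close>
    proof -
      have wr: "w * r \<le> 2 * b\<^sup>2"
      proof -
        have "1 * (w * r) \<le> v\<^sup>2 * (w * r)" using pos by (intro mult_le_mono1) simp
        also have "\<dots> = b\<^sup>2 + 1" using r by simp
        also have "\<dots> \<le> 2 * b\<^sup>2" using ab by simp
        finally show ?thesis by simp
      qed
      have "D \<le> w\<^sup>2 * r" using D by simp
      also have "\<dots> \<le> w\<^sup>2 * r\<^sup>2" using pos by (simp add: power2_eq_square)
      also have "\<dots> = (w * r)\<^sup>2" by (simp add: power_mult_distrib)
      also have "\<dots> \<le> (2 * b\<^sup>2)\<^sup>2" using wr by (intro power_mono) auto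
      finally have "X \<le> b\<^sup>2 * (2 * b\<^sup>2)\<^sup>2 * (2 * b\<^sup>2)"
        unfolding X_def using wr su by (intro mult_le_mono[OF mult_le_mono])
      also have "\<dots> = 8 * b ^ 8" by algebra
      finally have "real X \<le> real (8 * b ^ 8)" by (simp only: of_nat_le_iff)
      then have "real X powr (1 / 120) \<le> (8 * real b ^ 8) powr (1 / 120)"
        by (intro powr_mono2) auto
      also have "\<dots> = 8 powr (1 / 120) * E"
        using ab by (simp add: powr_mult E_def powr_powr powr_realpow[symmetric] del: powr_numeral)
      also have "\<dots> \<le> 8 powr 1 * E"
        using E by (intro mult_right_mono powr_mono) auto
      finally show ?thesis using C by (intro mult_left_mono) auto
    qed
    finally have "real w * (real w * real r) \<le>
        (8 * C * E * (real s * real u) * real D) * (real w * real r)"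
      by (simp add: X_def power2_eq_square algebra_simps)
    then have "real w \<le> 8 * C * E * (real s * real u) * real D"
      using pos by simp
    \<comment> \<open>Multiplying by \<open>v\<^sup>2\<close> makes \<open>D\<close> disappear
      through \<open>vD\<close>.\<close>
    then have "real v ^ 2 * real w \<le> real v ^ 2 * (8 * C * E * (real s * real u) * real D)"
      by (intro mult_left_mono) auto
    also have "\<dots> = 8 * C * E * (real s * real u) * real (v\<^sup>2 * D)" by simp
    also have "\<dots> = 8 * C * E * (real s * real u) * (real w + real s * real u ^ 2)"
      unfolding vD by simp
    finally have vw: "real v ^ 2 * real w \<le>
        8 * C * E * (real s * real u) * (real w + real s * real u ^ 2)" .
    have u4': "real u ^ 4 \<le> real r * real a ^ 2"
      and sr': "real s * real r * real a ^ 4 \<le> real b ^ 4"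
      using u4 sr by (metis of_nat_le_iff of_nat_mult of_nat_power)+
    have coeff: "8 * C * E * (real s * real u) \<ge> 0" using C E by simp
    have "real a ^ 26 \<le> L ^ 4 * real b ^ 24"
    \<comment> \<open>Split by the dominant term of \<open>w + s * u\<^sup>2\<close>; doubling it
      turns the constant 8 into the 16 of \<open>L\<close>.\<close>
    proof (cases "s * u\<^sup>2 \<le> w")
      case True
      then have "real s * real u ^ 2 \<le> real w" by (metis of_nat_le_iff of_nat_mult of_nat_power)
      then have "8 * C * E * (real s * real u) * (real w + real s * real u ^ 2)
          \<le> 8 * C * E * (real s * real u) * (2 * real w)"
        by (intro mult_left_mono coeff) auto
      with vw have "real v ^ 2 * real w \<le> (L * (real s * real u)) * real w"
        by (simp add: L_def algebra_simps)
      then have "real v ^ 2 \<le> L * (real s * real u)" using pos by simp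
      then have "real u ^ 2 * real v ^ 2 \<le> real u ^ 2 * (L * (real s * real u))"
        by (intro mult_left_mono) auto
      then have "real a ^ 2 \<le> L * real s * real u ^ 3"
        by (simp add: v power_mult_distrib power2_eq_square power3_eq_cube algebra_simps)
      then show ?thesis
        using power_bound_first_case[of "real a" "real b" "real u" "real s" "real r" L]
          ab pos L u4' sr' by simp
    next
      case False
      then have "real w \<le> real s * real u ^ 2"
        by (metis nat_le_linear of_nat_le_iff of_nat_mult of_nat_power)
      then have "8 * C * E * (real s * real u) * (real w + real s * real u ^ 2)
          \<le> 8 * C * E * (real s * real u) * (2 * (real s * real u ^ 2))"
        by (intro mult_left_mono coeff) auto
      with vw have "real v ^ 2 * real w \<le> L * real s ^ 2 * real u ^ 3"
        by (simp add: L_def power2_eq_square power3_eq_cube algebra_simps)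
      \<comment> \<open>The factor \<open>r\<close> completes the left side to
        \<open>b\<^sup>2 + 1\<close>.\<close>
      then have "real v ^ 2 * real w * real r \<le> L * real s ^ 2 * real u ^ 3 * real r"
        by (intro mult_right_mono) auto
      moreover have "real b ^ 2 \<le> real v ^ 2 * real w * real r"
        using arg_cong[OF r, of real] by simp
      ultimately have "real b ^ 2 \<le> L * real r * real s ^ 2 * real u ^ 3"
        by (simp add: algebra_simps)
      then show ?thesis
        using power_bound_second_case[of "real a" "real b" "real u" "real s" "real r" L]
          ab pos L u4' sr' by simp
    qed
    then show ?thesis by (simp add: L_def E_def)
  qed
  then show thesis using that[of "16 * C"] C by simp
qed

theorem theorem2:
  assumes "abc_conjecture"
  shows "\<forall>\<epsilon>::real. \<epsilon> > 0 \<longrightarrow>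
           (\<exists>C'::real. C' > 0 \<and>
             (\<forall>a b::nat. a > 0 \<longrightarrow> b > 0 \<longrightarrow> a < b \<longrightarrow>
                a\<^sup>2 * (a\<^sup>2 + 1) dvd b\<^sup>2 * (b\<^sup>2 + 1) \<longrightarrow>
                real b \<ge> C' * real a powr (15 / 14 - \<epsilon>)))"
proof -
  obtain K :: real where K: "K > 0"
    and bound: "\<And>a b :: nat. \<lbrakk>a > 0; a < b; a\<^sup>2 * (a\<^sup>2 + 1) dvd b\<^sup>2 * (b\<^sup>2 + 1)\<rbrakk>
           \<Longrightarrow> real a ^ 26 \<le> (K * real b powr (1 / 15)) ^ 4 * real b ^ 24"
    using abc_power_bound[OF assms] by blast
  \<comment> \<open>One constant serves every \<epsilon>, since the exponent 15/14 itself is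
    reached.\<close>
  have "K powr (- 15 / 91) * real a powr (15 / 14 - \<epsilon>) \<le> real b"
    if "\<epsilon> > 0" "a > 0" "a < b" "a\<^sup>2 * (a\<^sup>2 + 1) dvd b\<^sup>2 * (b\<^sup>2 + 1)" for a b :: nat and \<epsilon> :: real
  proof -
    have "real a powr 26 \<le> K powr 4 * real b powr (364 / 15)"
    proof -
      have "(K * real b powr (1 / 15)) ^ 4 * real b ^ 24
          = K powr 4 * (real b powr (4 / 15) * real b powr 24)"
        using K that by (simp add: power_mult_distrib powr_power)
      also have "\<dots> = K powr 4 * real b powr (364 / 15)"
        by (simp only: powr_add[symmetric]) simp
      finally show ?thesis using bound[OF that(2-4)] that(2) by simp
    qed
    \<comment> \<open>15/364 is the inverse of 24 + 4/15; it sends the exponent 26 to 15/14 and 4 to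
      15/91.\<close>
    then have "(real a powr 26) powr (15 / 364)
        \<le> (K powr 4 * real b powr (364 / 15)) powr (15 / 364)"
      by (intro powr_mono2) auto
    then have "real a powr (15 / 14) \<le> K powr (15 / 91) * real b"
      using that K by (simp add: powr_powr powr_mult del: powr_numeral)
    moreover have "real a powr (15 / 14 - \<epsilon>) \<le> real a powr (15 / 14)"
      using that by (intro powr_mono) auto
    ultimately have "K powr (- 15 / 91) * real a powr (15 / 14 - \<epsilon>)
        \<le> K powr (- 15 / 91) * (K powr (15 / 91) * real b)"
      by (intro mult_left_mono) auto
    also have "\<dots> = real b" using K by (simp add: mult.assoc[symmetric] powr_add[symmetric])
    finally show ?thesis .
  qed
  then show ?thesis using K by (metis powr_gt_zero less_numeral_extra(3))
qed

end
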